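(* Suppose that $r$ is bounded and upper semi-continuous, $p$ is upper semi-continuous, and $\Gamma$ is upper semi-continuous with $\Gamma(s)$ non-empty and compact for each $s\in S$. Then the value function $V$ is the unique bounded and upper semi-continuous function $S\to\mathbb{R}$ that satisfies the Bellman equation $TV=V$, and there exists a Borel measurable stationary policy that is optimal.
   Context: Discounted dynamic programming model (infinite horizon). $S$ (states) is a separable complete metric space with Borel $\sigma$-algebra $\mathcal{B}(S)$; measurable always means Borel measurable. $A \subseteq \mathbb{R}^k$ (actions) is a measurable set. $\Gamma:S\to 2^A$ assigns to each $s$ a measurable set $\Gamma(s)$ of feasible actions. $p : S\times A\times \mathcal{B}(S)\to[0,1]$ is a transition probability: $p(s,a,\cdot)$ is a probability measure on $S$ for each $(s,a)$ and $p(\cdot,\cdot,B)$ is measurable for each $B$. $r:S\times A\to\mathbb{R}$ is a measurable payoff function. $\beta\in(0,1)$ is the discount factor. Strategies: let $H^t = S\times (A\times S)^{t-1}$. A strategy $\sigma=(\sigma_1,\sigma_2,\dots)$ is a sequence of Borel measurable functions $\sigma_t:H^t\to A$ with $\sigma_t(s(1),a(1),\dots,s(t))\in\Gamma(s(t))$ for all $t$ and all histories. Given initial state $s(1)=s$, $\sigma$ and $p$ induce a probability measure on infinite histories, with expectation $\mathbb{E}_\sigma$ and process $\{s(t),a(t)\}_{t\ge1}$. Put $V_\sigma(s)=\mathbb{E}_\sigma\sum_{t=1}^\infty \beta^{t-1}r(s(t),a(t))$ and $V(s)=\sup_\sigma V_\sigma(s)$ (the value function). A stationary policy is a measurable $\lambda:S\to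 A$ with $\lambda(s)\in\Gamma(s)$ for all $s$, identified with the strategy playing $\lambda(s(t))$ at every history. A strategy $\sigma$ is optimal if $V_\sigma(s)=V(s)$ for all $s$. The Bellman operator is $Tf(s)=\sup_{a\in\Gamma(s)}\left[r(s,a)+\beta\int_S f(s')\,p(s,a,ds')\right]$. Upper semi-continuity: a function $f:X\to\mathbb{R}$ on a metric space is upper semi-continuous (u.s.c.) if $\{x:f(x)<\alpha\}$ is open for all $\alpha\in\mathbb{R}$. The kernel $p$ is u.s.c. if $(s,a)\mapsto\int_S f(s')p(s,a,ds')$ is u.s.c. and bounded whenever $f:S\to\mathbb{R}$ is u.s.c. and bounded. The correspondence $\Gamma$ is u.s.c. if $\{s\in S:\Gamma(s)\subseteq U\}$ is open whenever $U$ is open in $A$. *)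

theory Defs
  imports "HOL-Probability.Probability"
begin

section \<open>Upper semi-continuity\<close>

text \<open>Upper semi-continuity on a subset \<open>X\<close>, which carries the subspace topology.\<close>

definition usc_on :: "'x::topological_space set \<Rightarrow> ('x \<Rightarrow> real) \<Rightarrow> bool" where
  "usc_on X f \<longleftrightarrow> (\<forall>\<alpha>. openin (top_of_set X) {x \<in> X. f x < \<alpha>})"

definition bounded_on :: "'x set \<Rightarrow> ('x \<Rightarrow> real) \<Rightarrow> bool" where
  "bounded_on X f \<longleftrightarrow> bounded (f ` X)"

definition usc_correspondence ::
    "'y::topological_space set \<Rightarrow> ('s::topological_space \<Rightarrow> 'y set) \<Rightarrow> bool" where
  "usc_correspondence A \<Gamma> \<longleftrightarrow> (\<forall>U. openin (top_of_set A) U \<longrightarrow> open {s. \<Gamma> s \<subseteq> U})"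

definition usc_kernel ::
    "(real ^ 'k) set \<Rightarrow> ('s::polish_space \<times> (real ^ 'k) \<Rightarrow> 's measure) \<Rightarrow> bool" where
  "usc_kernel A p \<longleftrightarrow>
    (\<forall>f. usc_on UNIV f \<and> bounded_on UNIV f \<longrightarrow>
      usc_on (UNIV \<times> A) (\<lambda>sa. \<integral>s'. f s' \<partial>p sa) \<and>
      bounded_on (UNIV \<times> A) (\<lambda>sa. \<integral>s'. f s' \<partial>p sa))"

section \<open>The model\<close>

text \<open>The state space is the whole type \<open>'s\<close>. Since \<open>p\<close> and \<open>r\<close> are total functions,
  their values outside \<open>S \<times> A\<close> are left unconstrained.\<close>

definition state_action :: "(real ^ 'k) set \<Rightarrow> ('s::polish_space \<times> (real ^ 'k)) measure" where
  "state_action A = borel \<Otimes>\<^sub>M restrict_space borel A"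

locale discounted_model =
  fixes A :: "(real ^ 'k) set"
    and \<Gamma> :: "'s::polish_space \<Rightarrow> (real ^ 'k) set"
    and p :: "'s \<times> (real ^ 'k) \<Rightarrow> 's measure"
    and r :: "'s \<times> (real ^ 'k) \<Rightarrow> real"
    and \<beta> :: real
  assumes actions_measurable: "A \<in> sets borel"
    and feasible_subset: "\<Gamma> s \<subseteq> A"
    and feasible_measurable: "\<Gamma> s \<in> sets borel"
    and transition: "p \<in> state_action A \<rightarrow>\<^sub>M prob_algebra borel"
    and payoff_measurable: "r \<in> borel_measurable (state_action A)"
    and discount: "0 < \<beta>" "\<beta> < 1"

section \<open>Strategies\<close>

text \<open>
  Time is counted from 0, so index \<open>n\<close> stands for period \<open>t = n + 1\<close>.
  A history \<open>(s(1), a(1), \<dots>, a(t-1), s(t))\<close> in \<open>S \<times> (A \<times> S)\<^bsup>t-1\<^esup>\<close> is regrouped as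
  \<open>((s(1), a(1)), \<dots>, (s(t-1), a(t-1)))\<close>, a function \<open>h\<close> on \<open>{0..<n}\<close>,
  together with the current state \<open>s(t)\<close>.
\<close>

type_synonym ('s, 'k) strat = "nat \<Rightarrow> (nat \<Rightarrow> 's \<times> (real ^ 'k)) \<Rightarrow> 's \<Rightarrow> real ^ 'k"

definition strategy ::
    "(real ^ 'k) set \<Rightarrow> ('s::polish_space \<Rightarrow> (real ^ 'k) set) \<Rightarrow> ('s, 'k) strat \<Rightarrow> bool" where
  "strategy A \<Gamma> \<sigma> \<longleftrightarrow>
    (\<forall>n. (\<lambda>(h, s). \<sigma> n h s) \<in>
        (\<Pi>\<^sub>M i\<in>{0..<n}. state_action A) \<Otimes>\<^sub>M borel \<rightarrow>\<^sub>M restrict_space borel A) \<and>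
    (\<forall>n. \<forall>h \<in> space (\<Pi>\<^sub>M i\<in>{0..<n}. state_action A). \<forall>s. \<sigma> n h s \<in> \<Gamma> s)"

definition stationary_policy ::
    "(real ^ 'k) set \<Rightarrow> ('s::polish_space \<Rightarrow> (real ^ 'k) set) \<Rightarrow> ('s \<Rightarrow> real ^ 'k) \<Rightarrow> bool" where
  "stationary_policy A \<Gamma> \<pi> \<longleftrightarrow> \<pi> \<in> borel \<rightarrow>\<^sub>M restrict_space borel A \<and> (\<forall>s. \<pi> s \<in> \<Gamma> s)"

definition stationary_strategy :: "('s \<Rightarrow> real ^ 'k) \<Rightarrow> ('s, 'k) strat" where
  "stationary_strategy \<pi> = (\<lambda>n h s. \<pi> s)"

section \<open>The induced measure on infinite histories\<close>

text \<open>The conditional law of the state-action pair at index \<open>n\<close> given the preceding pairs \<open>h\<close>: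
  the state is drawn from \<open>p\<close> (it is the initial state \<open>s\<^sub>0\<close> if \<open>n = 0\<close>), and the action is
  the one prescribed by \<open>\<sigma>\<close>.\<close>

definition step_kernel ::
    "(real ^ 'k) set \<Rightarrow> ('s::polish_space \<times> (real ^ 'k) \<Rightarrow> 's measure) \<Rightarrow> ('s, 'k) strat \<Rightarrow> 's \<Rightarrow>
      nat \<Rightarrow> (nat \<Rightarrow> 's \<times> (real ^ 'k)) \<Rightarrow> ('s \<times> (real ^ 'k)) measure" where
  "step_kernel A p \<sigma> s\<^sub>0 n h =
    distr (case n of 0 \<Rightarrow> return borel s\<^sub>0 | Suc m \<Rightarrow> p (h m))
      (state_action A) (\<lambda>s. (s, \<sigma> n h s))"

text \<open>The projective limit given by the Ionescu Tulcea theorem: in that locale, it is the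
  measure called \<open>PF.lim\<close>.\<close>

definition history_measure ::
    "(real ^ 'k) set \<Rightarrow> ('s::polish_space \<times> (real ^ 'k) \<Rightarrow> 's measure) \<Rightarrow> ('s, 'k) strat \<Rightarrow> 's \<Rightarrow>
      (nat \<Rightarrow> 's \<times> (real ^ 'k)) measure" where
  "history_measure A p \<sigma> s\<^sub>0 =
    projective_family.lim UNIV
      (Ionescu_Tulcea.CI (step_kernel A p \<sigma> s\<^sub>0) (\<lambda>_. state_action A))
      (\<lambda>_. state_action A)"

lemma (in discounted_model) Ionescu_Tulcea_step_kernel:
  assumes "strategy A \<Gamma> \<sigma>"
  shows "Ionescu_Tulcea (step_kernel A p \<sigma> s\<^sub>0) (\<lambda>_. state_action A)"
proof (rule Ionescu_Tulcea.intro)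
  let ?M = "\<lambda>_::nat. state_action A :: ('s \<times> (real ^ 'k)) measure"
  let ?q = "\<lambda>n h. case n of 0 \<Rightarrow> return borel s\<^sub>0 | Suc m \<Rightarrow> p (h m)"
  have q: "?q n \<in> PiM {0..<n} ?M \<rightarrow>\<^sub>M prob_algebra borel" for n
  proof (cases n)
    case 0
    then show ?thesis
      by (simp add: space_prob_algebra prob_space_return)
  next
    case (Suc m)
    then show ?thesis
      using measurable_compose[OF measurable_component_singleton[of m "{0..<n}" ?M] transition]
      by simp
  qed
  have \<sigma>: "(\<lambda>(h, s). \<sigma> n h s) \<in> PiM {0..<n} ?M \<Otimes>\<^sub>M borel \<rightarrow>\<^sub>M restrict_space borel A" for n
    using assms by (auto simp: strategy_def)
  have pair: "(\<lambda>(h, s). (s, \<sigma> n h s)) \<in> PiM {0..<n} ?M \<Otimes>\<^sub>M borel \<rightarrow>\<^sub>M state_action A" for n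
    using measurable_Pair[OF measurable_snd \<sigma>[of n]]
    by (simp add: state_action_def split_beta')
  show "step_kernel A p \<sigma> s\<^sub>0 n \<in> PiM {0..<n} ?M \<rightarrow>\<^sub>M subprob_algebra (state_action A)" for n
    unfolding step_kernel_def
    using measurable_distr2[OF pair measurable_prob_algebraD[OF q]] by simp
  show "prob_space (step_kernel A p \<sigma> s\<^sub>0 n h)" if h: "h \<in> space (PiM {0..<n} ?M)" for n h
  proof -
    have "prob_space (?q n h)" and s: "sets (?q n h) = sets borel"
      using measurable_space[OF q h] by (auto simp: space_prob_algebra)
    moreover have "(\<lambda>s. (s, \<sigma> n h s)) \<in> ?q n h \<rightarrow>\<^sub>M state_action A"
      using measurable_compose[OF measurable_Pair1'[OF h] pair]
      by (subst measurable_cong_sets[OF s refl]) simp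
    ultimately show ?thesis
      unfolding step_kernel_def by (auto intro: prob_space.prob_space_distr)
  qed
qed

section \<open>Values, optimality and the Bellman operator\<close>

definition strategy_value ::
    "(real ^ 'k) set \<Rightarrow> ('s::polish_space \<times> (real ^ 'k) \<Rightarrow> 's measure) \<Rightarrow> ('s \<times> (real ^ 'k) \<Rightarrow> real) \<Rightarrow>
      real \<Rightarrow> ('s, 'k) strat \<Rightarrow> 's \<Rightarrow> real" where
  "strategy_value A p r \<beta> \<sigma> s = (\<integral>\<omega>. (\<Sum>n. \<beta> ^ n * r (\<omega> n)) \<partial>history_measure A p \<sigma> s)"

text \<open>The two suprema below are taken in the reals, where they have their usual meaning for
  nonempty sets that are bounded above. For bounded \<open>r\<close> and \<open>f\<close> the sets are bounded.\<close>

definition value_function ::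
    "(real ^ 'k) set \<Rightarrow> ('s::polish_space \<Rightarrow> (real ^ 'k) set) \<Rightarrow>
      ('s \<times> (real ^ 'k) \<Rightarrow> 's measure) \<Rightarrow> ('s \<times> (real ^ 'k) \<Rightarrow> real) \<Rightarrow> real \<Rightarrow> 's \<Rightarrow> real" where
  "value_function A \<Gamma> p r \<beta> s = (SUP \<sigma> \<in> {\<sigma>. strategy A \<Gamma> \<sigma>}. strategy_value A p r \<beta> \<sigma> s)"

definition optimal_strategy ::
    "(real ^ 'k) set \<Rightarrow> ('s::polish_space \<Rightarrow> (real ^ 'k) set) \<Rightarrow>
      ('s \<times> (real ^ 'k) \<Rightarrow> 's measure) \<Rightarrow> ('s \<times> (real ^ 'k) \<Rightarrow> real) \<Rightarrow> real \<Rightarrow> ('s, 'k) strat \<Rightarrow> bool" where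
  "optimal_strategy A \<Gamma> p r \<beta> \<sigma> \<longleftrightarrow> strategy A \<Gamma> \<sigma> \<and>
    (\<forall>s. strategy_value A p r \<beta> \<sigma> s = value_function A \<Gamma> p r \<beta> s)"

definition bellman ::
    "('s::polish_space \<Rightarrow> (real ^ 'k) set) \<Rightarrow> ('s \<times> (real ^ 'k) \<Rightarrow> 's measure) \<Rightarrow>
      ('s \<times> (real ^ 'k) \<Rightarrow> real) \<Rightarrow> real \<Rightarrow> ('s \<Rightarrow> real) \<Rightarrow> 's \<Rightarrow> real" where
  "bellman \<Gamma> p r \<beta> f s = (SUP a \<in> \<Gamma> s. r (s, a) + \<beta> * (\<integral>s'. f s' \<partial>p (s, a)))"

end

theory Submission
  imports Defs
begin

text \<open>The Bellman operator preserves bounded upper semi-continuous functions, because the maximum of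
  such a function over a compact-valued u.s.c. correspondence is u.s.c., and it contracts
  the supremum norm by \<open>\<beta>\<close>; iterating it from \<open>0\<close> gives a fixed point \<open>f\<close>. The correspondence of
  maximisers in the Bellman equation for \<open>f\<close> has compact values and admits a Borel selection \<open>\<pi>\<close>.
  Along any strategy, the discounted expectations of \<open>f (s(t)) - r (s(t), a(t)) - \<beta> \<integral> f dp\<close> telescope
  to \<open>f (s(1)) - V\<^sub>\<sigma> (s(1))\<close>. Each term is nonnegative as \<open>f = T f\<close>, and zero if \<open>\<sigma>\<close> plays \<open>\<pi>\<close>, so
  \<open>f = V\<close> for every fixed point \<open>f\<close>, and \<open>\<pi>\<close> is optimal.\<close>

section \<open>Upper semi-continuous functions\<close>

lemma usc_on_compose:
  assumes "usc_on X f" and "continuous_on Y g" and "g ` Y \<subseteq> X"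
  shows "usc_on Y (\<lambda>y. f (g y))"
  unfolding usc_on_def
proof
  fix \<alpha>
  have "{y \<in> Y. f (g y) < \<alpha>} = Y \<inter> g -` {x \<in> X. f x < \<alpha>}"
    using assms(3) by auto
  moreover have "openin (top_of_set Y) (Y \<inter> g -` {x \<in> X. f x < \<alpha>})"
    using assms by (intro continuous_openin_preimage[where T=X]) (auto simp: usc_on_def)
  ultimately show "openin (top_of_set Y) {y \<in> Y. f (g y) < \<alpha>}"
    by simp
qed

text \<open>The inequality \<open>f x + g x < \<alpha>\<close> holds exactly when some real
  \<open>q\<close> satisfies \<open>f x < q\<close> and \<open>g x < \<alpha> - q\<close>, so the
  sublevel set is a union of relatively open sets. The midpoint of \<open>f x\<close> and
  \<open>\<alpha> - g x\<close> serves as \<open>q\<close>.\<close>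

lemma usc_on_add:
  assumes "usc_on X f" and "usc_on X g"
  shows "usc_on X (\<lambda>x. f x + g x)"
  unfolding usc_on_def
proof
  fix \<alpha>
  have "{x \<in> X. f x + g x < \<alpha>} = (\<Union>q. {x \<in> X. f x < q} \<inter> {x \<in> X. g x < \<alpha> - q})"
  proof (intro set_eqI iffI)
    fix x assume x: "x \<in> {x \<in> X. f x + g x < \<alpha>}"
    then have "f x < (f x + (\<alpha> - g x)) / 2" "g x < \<alpha> - (f x + (\<alpha> - g x)) / 2"
      by (auto simp: field_simps)
    with x show "x \<in> (\<Union>q. {x \<in> X. f x < q} \<inter> {x \<in> X. g x < \<alpha> - q})"
      by blast
  qed auto
  moreover have "openin (top_of_set X) \<dots>"
    using assms unfolding usc_on_def by (intro openin_Union openin_Int) auto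
  ultimately show "openin (top_of_set X) {x \<in> X. f x + g x < \<alpha>}"
    by simp
qed

lemma usc_on_cmult:
  assumes "usc_on X f" and "0 < c"
  shows "usc_on X (\<lambda>x. c * f x)"
proof -
  have "{x \<in> X. c * f x < \<alpha>} = {x \<in> X. f x < \<alpha> / c}" for \<alpha>
    using assms(2) by (auto simp: field_simps)
  then show ?thesis
    using assms(1) by (simp add: usc_on_def)
qed

text \<open>This is the form of upper semi-continuity from which maximisers on compact sets are
  obtained.\<close>

lemma usc_on_closed_superlevel:
  assumes "usc_on X f" and "closed X"
  shows "closed {x \<in> X. q \<le> f x}"
proof -
  have "{x \<in> X. q \<le> f x} = X - {x \<in> X. f x < q}"
    by auto
  moreover have "closedin (top_of_set X) (X - {x \<in> X. f x < q})"
    using assms(1) by (intro closedin_diff) (auto simp: usc_on_def)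
  ultimately show ?thesis
    using closedin_closed_trans[OF _ assms(2)] by simp
qed

text \<open>The superlevel sets at the heights \<open>h y\<close> with \<open>y \<in> K\<close> are
  closed and have the finite intersection property: among finitely many such \<open>y\<close>, one
  with the largest height lies in all of them. By compactness a point lies in every superlevel set,
  and such a point is a maximiser.\<close>

lemma attains_max_if_closed_superlevel:
  fixes h :: "'a::topological_space \<Rightarrow> real"
  assumes "compact K" and "K \<noteq> {}" and closed: "\<And>q. closed {x \<in> K. q \<le> h x}"
  shows "\<exists>x\<in>K. \<forall>y\<in>K. h y \<le> h x"
proof -
  have "K \<inter> (\<Inter>y\<in>K. {x \<in> K. h y \<le> h x}) \<noteq> {}"
  proof (rule compact_imp_fip_image[OF assms(1) closed])
    fix I assume I: "finite I" "I \<subseteq> K"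
    show "K \<inter> (\<Inter>y\<in>I. {x \<in> K. h y \<le> h x}) \<noteq> {}"
    proof (cases "I = {}")
      case False
      with I have "Max (h ` I) \<in> h ` I" and le: "\<And>y. y \<in> I \<Longrightarrow> h y \<le> Max (h ` I)"
        by auto
      then obtain x where "x \<in> I" "Max (h ` I) = h x"
        by auto
      with I le show ?thesis
        by (intro ex_in_conv[THEN iffD1] exI[of _ x]) auto
    qed (use assms(2) in simp)
  qed
  then show ?thesis
    by auto
qed

text \<open>A variant of Berge's maximum theorem. The closed set \<open>F\<close> is there for the measurability
  of the set of maximisers.\<close>

lemma usc_correspondence_open_sublevel:
  fixes \<Gamma> :: "'s::topological_space \<Rightarrow> 'y::topological_space set"
  assumes \<Gamma>: "usc_correspondence A \<Gamma>" "\<And>s. \<Gamma> s \<subseteq> A" "\<And>s. compact (\<Gamma> s)"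
    and g: "usc_on (UNIV \<times> A) g" and F: "closed F"
  shows "open {s. \<forall>a\<in>\<Gamma> s \<inter> F. g (s, a) < \<alpha>}"
proof -
  obtain W where "open W" and W: "{x \<in> UNIV \<times> A. g x < \<alpha>} = (UNIV \<times> A) \<inter> W"
    using g unfolding usc_on_def openin_open by metis
  \<comment> \<open>Adding all actions outside \<open>F\<close> to \<open>W\<close> makes the
    condition vacuous there, so the tube lemma applies to the whole compact set
    \<open>\<Gamma> s\<close> instead of \<open>\<Gamma> s \<inter> F\<close>.\<close>
  define W' where "W' = W \<union> UNIV \<times> (- F)"
  have "open W'"
    unfolding W'_def using \<open>open W\<close> F by (intro open_Un open_Times) auto
  have good: "g (s, a) < \<alpha> \<longleftrightarrow> (s, a) \<in> W'" if "a \<in> \<Gamma> s \<inter> F" for s a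
    using W \<Gamma>(2)[of s] that unfolding W'_def by auto
  show ?thesis
  proof (subst openin_subopen[of euclidean, simplified], intro ballI)
    fix s assume s: "s \<in> {s. \<forall>a\<in>\<Gamma> s \<inter> F. g (s, a) < \<alpha>}"
    have "{s} \<times> \<Gamma> s \<subseteq> W'"
      using s good by (auto simp: W'_def)
    then obtain U V where UV: "open U" "open V" "s \<in> U" "\<Gamma> s \<subseteq> V" "U \<times> V \<subseteq> W'"
      using tube_lemma_right[of euclidean euclidean W' "\<Gamma> s" s] \<open>open W'\<close> \<Gamma>(3)[of s]
      by (auto simp: prod_topology_euclidean)
    have "open {t. \<Gamma> t \<subseteq> A \<inter> V}"
      using \<Gamma>(1) UV(2) unfolding usc_correspondence_def by (metis openin_open_Int)
    then show "\<exists>T. open T \<and> s \<in> T \<and> T \<subseteq> {s. \<forall>a\<in>\<Gamma> s \<inter> F. g (s, a) < \<alpha>}"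
      using UV good \<Gamma>(2) by (intro exI[of _ "U \<inter> {t. \<Gamma> t \<subseteq> A \<inter> V}"]) auto
  qed
qed

text \<open>If \<open>F n + e\<close> strictly dominates \<open>g\<close> on all of
  \<open>X\<close>, then \<open>F n x < \<alpha> - e\<close> forces \<open>g x < \<alpha>\<close>.
  Uniform convergence supplies, for each \<open>x\<close> with \<open>g x < \<alpha>\<close>, such a
  pair with \<open>e\<close> half the gap, so these sublevel sets cover that of
  \<open>g\<close>.\<close>

lemma usc_on_uniform_limit:
  assumes F: "\<And>n. usc_on X (F n)" and lim: "uniform_limit X F g sequentially"
  shows "usc_on X g"
  unfolding usc_on_def
proof
  fix \<alpha>
  define I where "I = {(n, e). \<forall>y\<in>X. g y < F n y + e}"
  have "{x \<in> X. g x < \<alpha>} = (\<Union>(n, e)\<in>I. {x \<in> X. F n x < \<alpha> - e})"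
  proof (intro set_eqI iffI)
    fix x assume x: "x \<in> {x \<in> X. g x < \<alpha>}"
    define e where "e = (\<alpha> - g x) / 2"
    have "e > 0"
      using x by (simp add: e_def)
    then obtain n where n: "\<And>y. y \<in> X \<Longrightarrow> \<bar>F n y - g y\<bar> < e"
      using uniform_limitD[OF lim, of e] by (auto simp: eventually_sequentially dist_real_def)
    then have "(n, e) \<in> I"
      by (fastforce simp: I_def)
    moreover have "F n x < \<alpha> - e"
      using n[of x] x unfolding e_def by (simp add: field_simps abs_if split: if_splits)
    ultimately show "x \<in> (\<Union>(n, e)\<in>I. {x \<in> X. F n x < \<alpha> - e})"
      using x by blast
  qed (fastforce simp: I_def)
  moreover have "openin (top_of_set X) \<dots>"
    using F unfolding usc_on_def by (intro openin_Union) auto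
  ultimately show "openin (top_of_set X) {x \<in> X. g x < \<alpha>}"
    by simp
qed

lemma usc_on_imp_borel_measurable_state_action:
  fixes g :: "'s::polish_space \<times> (real ^ 'k) \<Rightarrow> real"
  assumes "usc_on (UNIV \<times> A) g"
  shows "g \<in> borel_measurable (state_action A)"
  unfolding borel_measurable_iff_less
proof
  fix \<alpha>
  \<comment> \<open>This is the identity, read as a map from \<open>state_action A\<close> to the
    Borel space of the product. Relatively open sets are its preimages of open sets, hence
    measurable.\<close>
  have id: "(\<lambda>x. (fst x, snd x)) \<in> state_action A \<rightarrow>\<^sub>M (borel :: ('s \<times> (real ^ 'k)) measure)"
    unfolding state_action_def borel_prod[symmetric]
    by (intro measurable_Pair measurable_fst measurable_compose[OF measurable_snd]
        measurable_restrict_space1) auto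
  obtain W where "open W" and W: "{x \<in> UNIV \<times> A. g x < \<alpha>} = (UNIV \<times> A) \<inter> W"
    using assms unfolding usc_on_def openin_open by metis
  have "space (state_action A :: ('s \<times> (real ^ 'k)) measure) = UNIV \<times> A"
    by (simp add: state_action_def space_pair_measure space_restrict_space)
  with W have "{w \<in> space (state_action A). g w < \<alpha>} =
      (\<lambda>x. (fst x, snd x)) -` W \<inter> space (state_action A)"
    by auto
  then show "{w \<in> space (state_action A). g w < \<alpha>} \<in> sets (state_action A)"
    using measurable_sets[OF id borel_open[OF \<open>open W\<close>]] by metis
qed

lemma usc_on_imp_borel_measurable:
  assumes "usc_on UNIV f"
  shows "f \<in> borel_measurable borel"
  using assms unfolding borel_measurable_iff_less usc_on_def by simp

section \<open>Measurable selection\<close>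

text \<open>A maximiser lies in \<open>F\<close> iff every rational level reached on
  \<open>M s\<close> is also reached on \<open>M s \<inter> F\<close>. This turns the hitting set
  into a countable combination of the sets in \<open>hit\<close>.\<close>

lemma argmax_hit_measurable:
  fixes h :: "'s \<Rightarrow> 'a::topological_space \<Rightarrow> real"
  assumes M: "\<And>s. compact (M s)" "\<And>s. M s \<noteq> {}"
    and h: "\<And>s q. closed {a \<in> M s. q \<le> h s a}"
    and hit: "\<And>F q. closed F \<Longrightarrow> {s \<in> space N. \<exists>a\<in>M s \<inter> F. q \<le> h s a} \<in> sets N"
    and F: "closed F"
  shows "{s \<in> space N. {a \<in> M s. \<forall>b\<in>M s. h s b \<le> h s a} \<inter> F \<noteq> {}} \<in> sets N"
proof -
  have max: "(\<exists>a\<in>M s \<inter> F. \<forall>b\<in>M s. h s b \<le> h s a) \<longleftrightarrow>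
      (\<forall>q\<in>\<rat>. (\<exists>a\<in>M s. q \<le> h s a) \<longrightarrow> (\<exists>a\<in>M s \<inter> F. q \<le> h s a))" (is "?L \<longleftrightarrow> ?R") for s
  proof
    assume ?L
    then show ?R
      by (meson IntD1 order_trans)
  next
    assume R: ?R
    obtain a where a: "a \<in> M s" "\<And>b. b \<in> M s \<Longrightarrow> h s b \<le> h s a"
      using attains_max_if_closed_superlevel[OF M h] by blast
    \<comment> \<open>Any rational below the maximum will do: by \<open>R\<close> this level is
      reached on \<open>M s \<inter> F\<close>, which is therefore nonempty.\<close>
    obtain q where q: "q \<in> \<rat>" "q < h s a"
      using Rats_dense_in_real[of "h s a - 1" "h s a"] by auto
    have "{x \<in> M s \<inter> F. q \<le> h s x} = {x \<in> M s. q \<le> h s x} \<inter> F" for q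
      by auto
    then have "closed {x \<in> M s \<inter> F. q \<le> h s x}" for q
      using h F by (metis closed_Int)
    moreover have "M s \<inter> F \<noteq> {}"
      using R q a(1) less_imp_le by blast
    ultimately obtain b where b: "b \<in> M s \<inter> F" "\<And>c. c \<in> M s \<inter> F \<Longrightarrow> h s c \<le> h s b"
      using attains_max_if_closed_superlevel[OF compact_Int_closed[OF M(1) F]] by blast
    have "h s a \<le> h s b"
    proof (rule ccontr)
      assume "\<not> h s a \<le> h s b"
      \<comment> \<open>A rational strictly between the maximum over \<open>M s \<inter> F\<close>
        and the maximum over \<open>M s\<close> contradicts \<open>R\<close>.\<close>
      then obtain q where "q \<in> \<rat>" "h s b < q" "q < h s a"
        using Rats_dense_in_real[of "h s b" "h s a"] by auto
      moreover from this R a(1) obtain c where "c \<in> M s \<inter> F" "q \<le> h s c"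
        by (meson less_imp_le)
      ultimately show False
        using b(2)[of c] by simp
    qed
    with a(2) b(1) show ?L
      by (meson order_trans)
  qed
  have "{s \<in> space N. {a \<in> M s. \<forall>b\<in>M s. h s b \<le> h s a} \<inter> F \<noteq> {}} =
      {s \<in> space N. \<exists>a\<in>M s \<inter> F. \<forall>b\<in>M s. h s b \<le> h s a}"
    by auto
  \<comment> \<open>Intersecting with \<open>UNIV\<close> lets \<open>hit\<close> cover the premise
    of the implication as well.\<close>
  also have "\<dots> = {s \<in> space N. \<forall>q::rat. (\<exists>a\<in>M s \<inter> UNIV. of_rat q \<le> h s a) \<longrightarrow>
      (\<exists>a\<in>M s \<inter> F. of_rat q \<le> h s a)}"
    unfolding max by (simp add: Rats_def)
  also have "\<dots> \<in> sets N"
    by (intro sets.sets_Collect_countable_All sets.sets_Collect_imp hit F closed_UNIV)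
  finally show ?thesis .
qed

lemma compact_argmax:
  fixes h :: "'a::t2_space \<Rightarrow> real"
  assumes "compact K" and "K \<noteq> {}" and h: "\<And>q. closed {x \<in> K. q \<le> h x}"
  shows "compact {x \<in> K. \<forall>y\<in>K. h y \<le> h x}"
proof -
  obtain a where "a \<in> K" "\<And>b. b \<in> K \<Longrightarrow> h b \<le> h a"
    using attains_max_if_closed_superlevel[OF assms] by blast
  then have "{x \<in> K. \<forall>y\<in>K. h y \<le> h x} = K \<inter> {x \<in> K. h a \<le> h x}"
    using order_trans by auto
  then show ?thesis
    using compact_Int_closed[OF assms(1) h] by metis
qed

text \<open>The selection is the lexicographically largest point: maximising the coordinates one after
  the other preserves the measurability of the correspondence and ends with singletons.\<close>

lemma measurable_selection_compact:
  fixes M :: "'s \<Rightarrow> 'a::euclidean_space set"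
  assumes "\<And>s. compact (M s)" "\<And>s. M s \<noteq> {}"
    and "\<And>F. closed F \<Longrightarrow> {s \<in> space N. M s \<inter> F \<noteq> {}} \<in> sets N"
  shows "\<exists>\<pi>. \<pi> \<in> borel_measurable N \<and> (\<forall>s. \<pi> s \<in> M s)"
proof -
  \<comment> \<open>Invariant of the induction: \<open>M'\<close> is a measurable, compact-valued
    subcorrespondence whose values have already collapsed to one point in the coordinates from
    \<open>B\<close>.\<close>
  define good where "good B M' \<longleftrightarrow>
      (\<forall>s. compact (M' s) \<and> M' s \<noteq> {} \<and> M' s \<subseteq> M s \<and>
        (\<forall>b\<in>B. \<forall>x\<in>M' s. \<forall>y\<in>M' s. x \<bullet> b = y \<bullet> b)) \<and>
      (\<forall>F. closed F \<longrightarrow> {s \<in> space N. M' s \<inter> F \<noteq> {}} \<in> sets N)" for B M'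
  have "\<exists>M'. good B M'" if "finite B" for B
    using that
  proof induction
    case empty
    then show ?case
      using assms by (intro exI[of _ M]) (auto simp: good_def)
  next
    case (insert b B)
    then obtain M' where "good B M'"
      by blast
    then have M': "\<And>s. compact (M' s)" "\<And>s. M' s \<noteq> {}" "\<And>s. M' s \<subseteq> M s"
        "\<And>b s x y. b \<in> B \<Longrightarrow> x \<in> M' s \<Longrightarrow> y \<in> M' s \<Longrightarrow> x \<bullet> b = y \<bullet> b"
        "\<And>F. closed F \<Longrightarrow> {s \<in> space N. M' s \<inter> F \<noteq> {}} \<in> sets N"
      unfolding good_def by blast+
    \<comment> \<open>Maximising the next coordinate fixes it, while the coordinates in
      \<open>B\<close> stay constant because \<open>L s\<close> is a subset of
      \<open>M' s\<close>.\<close>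
    define L where "L s = {a \<in> M' s. \<forall>c\<in>M' s. c \<bullet> b \<le> a \<bullet> b}" for s
    have half: "closed {x. q \<le> x \<bullet> b}" for q
      by (intro closed_Collect_le continuous_intros)
    have "{a \<in> M' s. q \<le> a \<bullet> b} = M' s \<inter> {x. q \<le> x \<bullet> b}" for s q
      by auto
    then have super: "closed {a \<in> M' s. q \<le> a \<bullet> b}" for s q
      using closed_Int[OF compact_imp_closed[OF M'(1)] half] by metis
    have hit: "{s \<in> space N. \<exists>a\<in>M' s \<inter> F. q \<le> a \<bullet> b} \<in> sets N" if "closed F" for F q
    proof -
      have "{s \<in> space N. \<exists>a\<in>M' s \<inter> F. q \<le> a \<bullet> b} =
          {s \<in> space N. M' s \<inter> (F \<inter> {x. q \<le> x \<bullet> b}) \<noteq> {}}"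
        by auto
      also have "\<dots> \<in> sets N"
        by (intro M'(5) closed_Int that half)
      finally show ?thesis .
    qed
    have L1: "{s \<in> space N. L s \<inter> F \<noteq> {}} \<in> sets N" if "closed F" for F
      unfolding L_def by (intro argmax_hit_measurable M' super hit that)
    have L2: "compact (L s)" for s
      unfolding L_def by (intro compact_argmax M' super)
    have L3: "L s \<noteq> {}" for s
      unfolding L_def using attains_max_if_closed_superlevel[OF M'(1,2) super] by blast
    have L4: "L s \<subseteq> M s" for s
      using M'(3) by (auto simp: L_def)
    have L5: "x \<bullet> c = y \<bullet> c" if "c \<in> insert b B" "x \<in> L s" "y \<in> L s" for c x y s
      using that M'(4)[of c x s y] by (auto simp: L_def intro: antisym)
    show ?case
      unfolding good_def
      by (intro exI[of _ L] conjI allI ballI impI) (assumption | rule L1 L2 L3 L4 L5)+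
  qed
  from this[OF finite_Basis] obtain M' where "good Basis M'"
    by blast
  then have M': "\<And>s. M' s \<noteq> {}" "\<And>s. M' s \<subseteq> M s"
      "\<And>b s x y. b \<in> Basis \<Longrightarrow> x \<in> M' s \<Longrightarrow> y \<in> M' s \<Longrightarrow> x \<bullet> b = y \<bullet> b"
      "\<And>F. closed F \<Longrightarrow> {s \<in> space N. M' s \<inter> F \<noteq> {}} \<in> sets N"
    unfolding good_def by blast+
  define \<pi> where "\<pi> s = (SOME x. x \<in> M' s)" for s
  have \<pi>: "\<pi> s \<in> M' s" for s
    unfolding \<pi>_def using M'(1) by (simp add: some_in_eq)
  \<comment> \<open>Agreement in all basis coordinates makes each value a singleton. Preimages under
    the choice function \<open>\<pi>\<close> are therefore the measurable hitting sets.\<close>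
  have "x = \<pi> s" if "x \<in> M' s" for x s
    using M'(3)[OF _ that \<pi>] by (rule euclidean_eqI)
  with \<pi> have "\<pi> -` F \<inter> space N = {s \<in> space N. M' s \<inter> F \<noteq> {}}" for F
    by (auto simp: disjoint_iff)
  then have "\<pi> \<in> borel_measurable N"
    unfolding borel_eq_closed using M'(4) by (intro measurable_measure_of) auto
  with \<pi> M'(2) show ?thesis
    by blast
qed

section \<open>The Bellman operator\<close>

locale usc_discounted_model = discounted_model A \<Gamma> p r \<beta>
  for A :: "(real ^ 'k) set"
    and \<Gamma> :: "'s::polish_space \<Rightarrow> (real ^ 'k) set"
    and p :: "'s \<times> (real ^ 'k) \<Rightarrow> 's measure"
    and r :: "'s \<times> (real ^ 'k) \<Rightarrow> real"
    and \<beta> :: real +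
  assumes payoff_bounded: "bounded_on (UNIV \<times> A) r"
    and payoff_usc: "usc_on (UNIV \<times> A) r"
    and kernel_usc: "usc_kernel A p"
    and feasible_usc: "usc_correspondence A \<Gamma>"
    and feasible_nonempty: "\<Gamma> s \<noteq> {}"
    and feasible_compact: "compact (\<Gamma> s)"
begin

text \<open>This is the Q-function for continuation value \<open>f\<close>; \<open>bellman\<close>
  takes its supremum over the feasible actions.\<close>

definition action_value :: "('s \<Rightarrow> real) \<Rightarrow> 's \<times> (real ^ 'k) \<Rightarrow> real" where
  "action_value f x = r x + \<beta> * (\<integral>s'. f s' \<partial>p x)"

definition bounded_usc :: "('s \<Rightarrow> real) \<Rightarrow> bool" where
  "bounded_usc f \<longleftrightarrow> bounded_on UNIV f \<and> usc_on UNIV f"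

section \<open>Bounds, integrability and attained maxima\<close>

lemma space_state_action: "space (state_action A :: ('s \<times> (real ^ 'k)) measure) = UNIV \<times> A"
  by (simp add: state_action_def space_pair_measure space_restrict_space)

lemma feasible_actions: "a \<in> \<Gamma> s \<Longrightarrow> a \<in> A"
  using feasible_subset by blast

lemma bounded_usc_bound:
  assumes "bounded_usc f"
  obtains B where "\<And>s. \<bar>f s\<bar> \<le> B"
  using assms by (auto simp: bounded_usc_def bounded_on_def bounded_iff)

lemma bounded_usc_measurable: "bounded_usc f \<Longrightarrow> f \<in> borel_measurable borel"
  by (simp add: bounded_usc_def usc_on_imp_borel_measurable)

lemma prob_space_p: "a \<in> A \<Longrightarrow> prob_space (p (s, a))"
  and sets_p: "a \<in> A \<Longrightarrow> sets (p (s, a)) = sets borel"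
  using measurable_space[OF transition, of "(s, a)"]
  by (auto simp: space_prob_algebra space_state_action)

lemma integrable_p:
  assumes "bounded_usc f" and "a \<in> A"
  shows "integrable (p (s, a)) f"
proof -
  interpret prob_space "p (s, a)"
    using assms(2) by (rule prob_space_p)
  obtain B where B: "\<And>s. \<bar>f s\<bar> \<le> B"
    using bounded_usc_bound[OF assms(1)] by blast
  have "f \<in> borel_measurable (p (s, a))"
    using bounded_usc_measurable[OF assms(1)] measurable_cong_sets[OF sets_p[OF assms(2)] refl]
    by blast
  then show ?thesis
    using B by (intro integrable_const_bound[of _ B]) auto
qed

lemma usc_on_action_value:
  assumes "bounded_usc f"
  shows "usc_on (UNIV \<times> A) (action_value f)"
proof -
  have "usc_on (UNIV \<times> A) (\<lambda>x. \<integral>s'. f s' \<partial>p x)"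
    using assms kernel_usc by (simp add: usc_kernel_def bounded_usc_def)
  then show ?thesis
    unfolding action_value_def [abs_def]
    by (intro usc_on_add usc_on_cmult payoff_usc discount)
qed

lemma payoff_bound: obtains B where "\<And>x. x \<in> UNIV \<times> A \<Longrightarrow> \<bar>r x\<bar> \<le> B"
  using payoff_bounded by (fastforce simp: bounded_on_def bounded_iff)

lemma integral_p_bound:
  assumes "bounded_usc f" and "\<And>s. \<bar>f s\<bar> \<le> B" and "a \<in> A"
  shows "\<bar>\<integral>s'. f s' \<partial>p (s, a)\<bar> \<le> B"
proof -
  interpret prob_space "p (s, a)"
    using assms(3) by (rule prob_space_p)
  have "(\<integral>s'. f s' \<partial>p (s, a)) \<le> B" "(\<integral>s'. f s' \<partial>p (s, a)) \<ge> - B"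
    using assms(2) by (auto intro!: integral_le_const integral_ge_const integrable_p assms(1,3)
        simp: abs_le_iff minus_le_iff)
  then show ?thesis
    by simp
qed

lemma closed_superlevel_action_value:
  assumes "bounded_usc f"
  shows "closed {a \<in> \<Gamma> s. q \<le> action_value f (s, a)}"
  using feasible_actions
  by (intro usc_on_closed_superlevel usc_on_compose[OF usc_on_action_value[OF assms]]
      continuous_intros compact_imp_closed feasible_compact) auto

lemma bellman_eq_if_max:
  assumes "a \<in> \<Gamma> s" and "\<And>b. b \<in> \<Gamma> s \<Longrightarrow> action_value f (s, b) \<le> action_value f (s, a)"
  shows "bellman \<Gamma> p r \<beta> f s = action_value f (s, a)"
  unfolding bellman_def action_value_def[symmetric]
  using assms by (intro cSup_eq_maximum) auto

text \<open>Compactness of \<open>\<Gamma> s\<close> turns the supremum into a maximum, so later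
  arguments work with a maximising action instead of a supremum in the reals.\<close>

lemma bellman_attained:
  assumes "bounded_usc f"
  shows "\<exists>a\<in>\<Gamma> s. bellman \<Gamma> p r \<beta> f s = action_value f (s, a) \<and>
    (\<forall>b\<in>\<Gamma> s. action_value f (s, b) \<le> action_value f (s, a))"
  using attains_max_if_closed_superlevel[OF feasible_compact feasible_nonempty
      closed_superlevel_action_value[OF assms]] bellman_eq_if_max
  by metis

lemma bellman_ge:
  assumes "bounded_usc f" and "a \<in> \<Gamma> s"
  shows "action_value f (s, a) \<le> bellman \<Gamma> p r \<beta> f s"
  using bellman_attained[OF assms(1)] assms(2) by metis

lemma bounded_usc_bellman:
  assumes "bounded_usc f"
  shows "bounded_usc (bellman \<Gamma> p r \<beta> f)"
  unfolding bounded_usc_def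
proof
  obtain B where B: "\<And>s. \<bar>f s\<bar> \<le> B"
    using bounded_usc_bound[OF assms] by blast
  obtain C where C: "\<And>x. x \<in> UNIV \<times> A \<Longrightarrow> \<bar>r x\<bar> \<le> C"
    using payoff_bound by blast
  have "\<bar>bellman \<Gamma> p r \<beta> f s\<bar> \<le> C + \<beta> * B" for s
  proof -
    obtain a where a: "a \<in> \<Gamma> s" "bellman \<Gamma> p r \<beta> f s = action_value f (s, a)"
      using bellman_attained[OF assms] by metis
    then have "a \<in> A"
      using feasible_actions by blast
    then have "\<bar>r (s, a)\<bar> \<le> C" "\<bar>\<beta> * (\<integral>s'. f s' \<partial>p (s, a))\<bar> \<le> \<beta> * B"
      using C integral_p_bound[OF assms B] discount by (auto simp: abs_mult)
    with a(2) show ?thesis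
      unfolding action_value_def by linarith
  qed
  then show "bounded_on UNIV (bellman \<Gamma> p r \<beta> f)"
    by (auto simp: bounded_on_def bounded_iff)
next
  \<comment> \<open>The strict inequality survives the passage to the supremum because the supremum
    is attained. With \<open>F = UNIV\<close> the set on the right is open by the variant of Berge's
    theorem.\<close>
  have "{s. bellman \<Gamma> p r \<beta> f s < \<alpha>} = {s. \<forall>a\<in>\<Gamma> s \<inter> UNIV. action_value f (s, a) < \<alpha>}" for \<alpha>
  proof (intro set_eqI iffI)
    fix s assume "s \<in> {s. bellman \<Gamma> p r \<beta> f s < \<alpha>}"
    then show "s \<in> {s. \<forall>a\<in>\<Gamma> s \<inter> UNIV. action_value f (s, a) < \<alpha>}"
      using bellman_ge[OF assms, of _ s] by (auto intro: le_less_trans)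
  next
    fix s assume s: "s \<in> {s. \<forall>a\<in>\<Gamma> s \<inter> UNIV. action_value f (s, a) < \<alpha>}"
    obtain a where "a \<in> \<Gamma> s" "bellman \<Gamma> p r \<beta> f s = action_value f (s, a)"
      using bellman_attained[OF assms] by metis
    with s show "s \<in> {s. bellman \<Gamma> p r \<beta> f s < \<alpha>}"
      by simp
  qed
  then show "usc_on UNIV (bellman \<Gamma> p r \<beta> f)"
    unfolding usc_on_def
    using usc_correspondence_open_sublevel[OF feasible_usc feasible_subset feasible_compact
        usc_on_action_value[OF assms] closed_UNIV]
    by simp
qed

section \<open>Contraction property and successive approximation\<close>

lemma bellman_le_add:
  assumes f: "bounded_usc f" and g: "bounded_usc g" and le: "\<And>s. f s \<le> g s + c"
  shows "bellman \<Gamma> p r \<beta> f s \<le> bellman \<Gamma> p r \<beta> g s + \<beta> * c"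
proof -
  \<comment> \<open>Comparing both action values at a maximiser for \<open>f\<close> gives
    Blackwell's two conditions, monotonicity and discounting of constants, in one
    inequality.\<close>
  obtain a where a: "a \<in> \<Gamma> s" "bellman \<Gamma> p r \<beta> f s = action_value f (s, a)"
    using bellman_attained[OF f] by metis
  then have A: "a \<in> A"
    using feasible_actions by blast
  interpret prob_space "p (s, a)"
    using A by (rule prob_space_p)
  have "(\<integral>s'. f s' \<partial>p (s, a)) \<le> (\<integral>s'. g s' + c \<partial>p (s, a))"
    using le by (intro integral_mono Bochner_Integration.integrable_add integrable_p f g A
        integrable_const)
  also have "\<dots> = (\<integral>s'. g s' \<partial>p (s, a)) + c"
    using integrable_p[OF g A] by (simp add: prob_space)
  finally have "\<beta> * (\<integral>s'. f s' \<partial>p (s, a)) \<le> \<beta> * ((\<integral>s'. g s' \<partial>p (s, a)) + c)"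
    using discount by simp
  then have "action_value f (s, a) \<le> action_value g (s, a) + \<beta> * c"
    by (simp add: action_value_def distrib_left)
  also have "\<dots> \<le> bellman \<Gamma> p r \<beta> g s + \<beta> * c"
    using bellman_ge[OF g a(1)] by simp
  finally show ?thesis
    using a(2) by simp
qed

lemma bellman_contraction:
  assumes "bounded_usc f" and "bounded_usc g" and "\<And>s. \<bar>f s - g s\<bar> \<le> c"
  shows "\<bar>bellman \<Gamma> p r \<beta> f s - bellman \<Gamma> p r \<beta> g s\<bar> \<le> \<beta> * c"
proof -
  have "f t \<le> g t + c" "g t \<le> f t + c" for t
    using assms(3)[of t] by auto
  then show ?thesis
    using bellman_le_add[OF assms(1,2)] bellman_le_add[OF assms(2,1)] by (smt (verit))
qed

lemma bellman_fixed_point_exists: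
  obtains v where "bounded_usc v" and "bellman \<Gamma> p r \<beta> v = v"
proof -
  let ?T = "bellman \<Gamma> p r \<beta>"
  define u where "u n = (?T ^^ n) (\<lambda>_. 0)" for n
  have u_Suc: "u (Suc n) = ?T (u n)" for n
    by (simp add: u_def)
  have u: "bounded_usc (u n)" for n
  proof (induction n)
    case 0
    show ?case
      by (auto simp: u_def bounded_usc_def bounded_on_def usc_on_def)
  qed (simp add: u_Suc bounded_usc_bellman)
  obtain B where B: "\<And>s. \<bar>u 1 s\<bar> \<le> B"
    using bounded_usc_bound[OF u] by blast
  have step: "\<bar>u (Suc n) s - u n s\<bar> \<le> \<beta> ^ n * B" for n s
  proof (induction n arbitrary: s)
    case 0
    then show ?case
      using B by (simp add: u_def)
  next
    case (Suc n)
    then show ?case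
      using bellman_contraction[OF u[of "Suc n"] u[of n] Suc.IH] by (simp add: u_Suc mult.assoc)
  qed
  have "u 0 s = 0" for s
    by (simp add: u_def)
  then have u_sum: "(\<Sum>k<n. u (Suc k) s - u k s) = u n s" for n s
    using sum_lessThan_telescope[of "\<lambda>k. u k s" n] by simp
  \<comment> \<open>As \<open>u 0\<close> vanishes, the partial sums are the iterates
    \<open>u n\<close>. The geometric bound \<open>step\<close> makes the series converge uniformly
    by the Weierstrass test.\<close>
  define v where "v s = (\<Sum>k. u (Suc k) s - u k s)" for s
  have "uniform_limit UNIV (\<lambda>n s. \<Sum>k<n. u (Suc k) s - u k s) v sequentially"
    unfolding v_def using step discount
    by (intro Weierstrass_m_test[of _ _ "\<lambda>n. \<beta> ^ n * B"] summable_mult2 summable_geometric) auto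
  then have lim: "uniform_limit UNIV u v sequentially"
    by (simp add: u_sum)
  \<comment> \<open>One index must serve two consecutive iterates: the distance from
    \<open>?T v\<close> to \<open>v\<close> is estimated through
    \<open>u (Suc n) = ?T (u n)\<close>.\<close>
  have close: "\<exists>n. \<forall>s. \<bar>u n s - v s\<bar> < e \<and> \<bar>u (Suc n) s - v s\<bar> < e" if "e > 0" for e
    using uniform_limitD[OF lim that]
    by (auto simp: eventually_sequentially dist_real_def intro: le_SucI)
  have v: "bounded_usc v"
    unfolding bounded_usc_def
  proof
    obtain n where n: "\<And>s. \<bar>u n s - v s\<bar> < 1"
      using close[of 1] by auto
    obtain C where C: "\<And>s. \<bar>u n s\<bar> \<le> C"
      using bounded_usc_bound[OF u] by metis
    have "\<bar>v s\<bar> \<le> C + 1" for s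
      using n[of s] C[of s] by linarith
    then show "bounded_on UNIV v"
      by (auto simp: bounded_on_def bounded_iff)
    show "usc_on UNIV v"
      using u by (intro usc_on_uniform_limit[OF _ lim]) (simp add: bounded_usc_def)
  qed
  have "?T v s = v s" for s
  proof -
    have "\<bar>?T v s - v s\<bar> \<le> e" if "e > 0" for e
    proof -
      obtain n where n: "\<And>s. \<bar>u n s - v s\<bar> < e / 2" "\<And>s. \<bar>u (Suc n) s - v s\<bar> < e / 2"
        using close[of "e / 2"] \<open>e > 0\<close> by auto
      have "\<bar>u (Suc n) s - ?T v s\<bar> \<le> \<beta> * (e / 2)"
        unfolding u_Suc using n(1) by (intro bellman_contraction u v less_imp_le)
      also have "\<dots> \<le> e / 2"
        using discount \<open>e > 0\<close> by (simp add: mult_left_le_one_le)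
      finally show ?thesis
        using n(2)[of s] by linarith
    qed
    then show ?thesis
      using field_le_epsilon[of "\<bar>?T v s - v s\<bar>" 0] by simp
  qed
  with v that show ?thesis
    by blast
qed

section \<open>Measurable choice of a maximising action\<close>

lemma bellman_maximiser_exists:
  assumes "bounded_usc f"
  obtains \<pi> where "stationary_policy A \<Gamma> \<pi>"
    and "\<And>s. bellman \<Gamma> p r \<beta> f s = action_value f (s, \<pi> s)"
proof -
  define M where "M s = {a \<in> \<Gamma> s. \<forall>b\<in>\<Gamma> s. action_value f (s, b) \<le> action_value f (s, a)}" for s
  \<comment> \<open>The complement is the open set from the variant of Berge's theorem, now with a
    general closed \<open>F\<close>.\<close>
  have hit: "{s \<in> space borel. \<exists>a\<in>\<Gamma> s \<inter> F. q \<le> action_value f (s, a)} \<in> sets borel"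
    if "closed F" for F q
  proof -
    have "{s \<in> space borel. \<exists>a\<in>\<Gamma> s \<inter> F. q \<le> action_value f (s, a)} =
        UNIV - {s. \<forall>a\<in>\<Gamma> s \<inter> F. action_value f (s, a) < q}"
      by (force simp: not_less)
    then show ?thesis
      using borel_open[OF usc_correspondence_open_sublevel[OF feasible_usc feasible_subset
            feasible_compact usc_on_action_value[OF assms] that]]
      by auto
  qed
  have "\<exists>\<pi>. \<pi> \<in> borel_measurable borel \<and> (\<forall>s. \<pi> s \<in> M s)"
  proof (rule measurable_selection_compact)
    show "compact (M s)" for s
      unfolding M_def
      by (rule compact_argmax[OF feasible_compact feasible_nonempty
            closed_superlevel_action_value[OF assms]])
    show "M s \<noteq> {}" for s
      using bellman_attained[OF assms, of s] unfolding M_def by blast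
    show "{s \<in> space borel. M s \<inter> F \<noteq> {}} \<in> sets borel" if "closed F" for F
      unfolding M_def
      by (rule argmax_hit_measurable[OF feasible_compact feasible_nonempty
            closed_superlevel_action_value[OF assms] hit that])
  qed
  then obtain \<pi> where \<pi>: "\<pi> \<in> borel_measurable borel" "\<forall>s. \<pi> s \<in> M s"
    by (elim exE conjE)
  have max: "\<pi> s \<in> \<Gamma> s" "\<And>b. b \<in> \<Gamma> s \<Longrightarrow> action_value f (s, b) \<le> action_value f (s, \<pi> s)" for s
    using \<pi>(2) by (simp_all add: M_def)
  show ?thesis
  proof
    have "\<pi> s \<in> A" for s
      using max(1) by (rule feasible_actions)
    then have "\<pi> \<in> borel \<rightarrow>\<^sub>M restrict_space borel A"
      using \<pi>(1) by (intro measurable_restrict_space2) simp_all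
    with max(1) show "stationary_policy A \<Gamma> \<pi>"
      by (simp add: stationary_policy_def)
    show "bellman \<Gamma> p r \<beta> f s = action_value f (s, \<pi> s)" for s
      using max by (rule bellman_eq_if_max)
  qed
qed

end

section \<open>Expectations under the history measure\<close>

context Ionescu_Tulcea
begin

text \<open>The finite-dimensional laws \<open>CI J\<close> are built from the kernel run up to time
  \<open>up_to J\<close>; this identifies that time for initial segments.\<close>

lemma up_to_lessThan: "up_to {0..<n} = n"
proof (rule antisym)
  show "up_to {0..<n} \<le> n"
    by (simp add: up_to_iff)
  show "n \<le> up_to {0..<n}"
    using up_to_less[of "{0..<n}" "up_to {0..<n}"] by force
qed

lemma integral_lim_restrict:
  fixes f :: "(nat \<Rightarrow> 'a) \<Rightarrow> real"
  assumes f: "f \<in> borel_measurable (PiM {0..<n} M)"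
  shows "(\<integral>\<omega>. f (restrict \<omega> {0..<n}) \<partial>PF.lim) = (\<integral>h. f h \<partial>C 0 n (\<lambda>_. undefined))"
proof -
  \<comment> \<open>The constant \<open>undefined\<close> is the empty history, from which the
    kernels \<open>C\<close> start at time 0.\<close>
  have "C 0 n (\<lambda>_. undefined) = CI {0..<n}"
    using distr_C[of n n "\<lambda>_. undefined" 0] by (simp add: CI_def up_to_lessThan)
  also have "\<dots> = distr PF.lim (PiM {0..<n} M) (\<lambda>\<omega>. restrict \<omega> {0..<n})"
    by (simp add: distr_lim)
  finally show ?thesis
    using f by (simp add: integral_distr measurable_cong_sets[OF PF.sets_lim refl]
        measurable_restrict_subset)
qed

text \<open>\<open>C 0 (Suc n)\<close> is \<open>C 0 n\<close> followed by \<open>eP n\<close>, and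
  \<open>eP n h\<close> extends \<open>h\<close> by a coordinate \<open>n\<close> drawn from
  \<open>P n h\<close>. So the expectation is computed by conditioning on the first \<open>n\<close>
  coordinates.\<close>

lemma integral_lim_component:
  fixes \<phi> :: "'a \<Rightarrow> real"
  assumes \<phi>: "\<phi> \<in> borel_measurable (M n)" and bound: "\<And>x. x \<in> space (M n) \<Longrightarrow> \<bar>\<phi> x\<bar> \<le> B"
  shows "(\<integral>\<omega>. \<phi> (\<omega> n) \<partial>PF.lim) = (\<integral>h. (\<integral>x. \<phi> x \<partial>P n h) \<partial>C 0 n (\<lambda>_. undefined))"
proof -
  let ?C = "C 0 n (\<lambda>_. undefined)"
  have comp: "(\<lambda>h. \<phi> (h n)) \<in> borel_measurable (PiM {0..<Suc n} M)"
    by (intro measurable_compose[OF _ \<phi>] measurable_component_singleton) simp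
  have C: "space ?C = space (PiM {0..<n} M)" "sets ?C = sets (PiM {0..<n} M)"
    by (simp_all add: space_C sets_C)
  interpret prob_space ?C
    by (simp add: prob_space_C)
  have "(\<integral>\<omega>. \<phi> (\<omega> n) \<partial>PF.lim) = (\<integral>h. \<phi> (h n) \<partial>C 0 (Suc n) (\<lambda>_. undefined))"
    using integral_lim_restrict[OF comp] by simp
  also have "\<dots> = (\<integral>h. (\<integral>g. \<phi> (g n) \<partial>eP n h) \<partial>?C)"
    unfolding C.simps add_0
  \<comment> \<open>\<open>B\<close> bounds the integrand and \<open>B'\<close> the mass of the
    kernel, which is 1 for the probability measures \<open>eP n h\<close>.\<close>
  proof (rule integral_bind[where K="PiM {0..<Suc n} M" and B=B and B'=1])
    show "\<bar>\<phi> (h n)\<bar> \<le> B" if "h \<in> space (PiM {0..<Suc n} M)" for h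
      using that by (intro bound) (auto simp: space_PiM)
    show "eP n \<in> ?C \<rightarrow>\<^sub>M subprob_algebra (PiM {0..<Suc n} M)"
      using measurable_eP measurable_cong_sets[OF C(2) refl] by blast
    show "AE h in ?C. emeasure (eP n h) (space (eP n h)) \<le> ennreal 1"
      using prob_space.emeasure_space_1[OF prob_space_eP] by (intro AE_I2) (simp add: C(1))
  qed (rule comp finite_measure_axioms)+
  also have "\<dots> = (\<integral>h. (\<integral>x. \<phi> x \<partial>P n h) \<partial>?C)"
  proof (intro Bochner_Integration.integral_cong refl)
    fix h assume "h \<in> space ?C"
    then have h: "h \<in> space (PiM {0..<n} M)"
      by (simp add: C(1))
    have "fun_upd h n \<in> P n h \<rightarrow>\<^sub>M PiM {0..<Suc n} M"
      using h by (intro measurable_fun_upd[where J="{0..<n}"]) (auto simp: sets_P)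
    then show "(\<integral>g. \<phi> (g n) \<partial>eP n h) = (\<integral>x. \<phi> x \<partial>P n h)"
      unfolding eP_def using comp by (simp add: integral_distr)
  qed
  finally show ?thesis .
qed

end

section \<open>Integration against the one-step kernel\<close>

context usc_discounted_model
begin

lemma strategy_pair_measurable:
  assumes "strategy A \<Gamma> \<sigma>" and "h \<in> space (PiM {0..<n} (\<lambda>_. state_action A))"
  shows "(\<lambda>s. (s, \<sigma> n h s)) \<in> borel \<rightarrow>\<^sub>M state_action A"
proof -
  have "(\<lambda>(h, s). \<sigma> n h s) \<in> PiM {0..<n} (\<lambda>_. state_action A) \<Otimes>\<^sub>M borel \<rightarrow>\<^sub>M restrict_space borel A"
    using assms(1) by (auto simp: strategy_def)
  from measurable_compose[OF measurable_Pair1'[OF assms(2)] this]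
  show ?thesis
    unfolding state_action_def by (intro measurable_Pair) auto
qed

lemma integral_step_kernel:
  fixes \<phi> :: "'s \<times> (real ^ 'k) \<Rightarrow> real"
  assumes \<sigma>: "strategy A \<Gamma> \<sigma>" and h: "h \<in> space (PiM {0..<n} (\<lambda>_. state_action A))"
    and \<phi>: "\<phi> \<in> borel_measurable (state_action A)"
  shows "(\<integral>x. \<phi> x \<partial>step_kernel A p \<sigma> s\<^sub>0 n h) =
    (\<integral>s. \<phi> (s, \<sigma> n h s) \<partial>(case n of 0 \<Rightarrow> return borel s\<^sub>0 | Suc m \<Rightarrow> p (h m)))"
proof -
  \<comment> \<open>\<open>p\<close> is constrained only where the action lies in \<open>A\<close>,
    so the successor case uses that \<open>h m\<close> belongs to the state-action space.\<close>
  have "sets (case n of 0 \<Rightarrow> return borel s\<^sub>0 | Suc m \<Rightarrow> p (h m)) = sets borel"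
  proof (cases n)
    case (Suc m)
    then have "h m \<in> space (state_action A)"
      using h by (auto simp: space_PiM)
    then show ?thesis
      using sets_p Suc by (auto simp: space_state_action)
  qed simp
  then show ?thesis
    unfolding step_kernel_def
    using strategy_pair_measurable[OF \<sigma> h] \<phi>
    by (intro integral_distr) (simp_all cong: measurable_cong_sets)
qed

end

section \<open>The process generated by one strategy from one initial state\<close>

locale strategy_process = usc_discounted_model A \<Gamma> p r \<beta>
  for A :: "(real ^ 'k) set"
    and \<Gamma> :: "'s::polish_space \<Rightarrow> (real ^ 'k) set"
    and p :: "'s \<times> (real ^ 'k) \<Rightarrow> 's measure"
    and r :: "'s \<times> (real ^ 'k) \<Rightarrow> real"
    and \<beta> :: real +
  fixes \<sigma> :: "('s, 'k) strat" and s\<^sub>0 :: 's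
  assumes strategy: "strategy A \<Gamma> \<sigma>"
begin

sublocale IT: Ionescu_Tulcea "step_kernel A p \<sigma> s\<^sub>0" "\<lambda>_. state_action A"
  using strategy by (rule Ionescu_Tulcea_step_kernel)

abbreviation "hist \<equiv> history_measure A p \<sigma> s\<^sub>0"

lemma space_hist: "space hist = space (PiM UNIV (\<lambda>_. state_action A))"
  and sets_hist: "sets hist = sets (PiM UNIV (\<lambda>_. state_action A))"
  by (simp_all add: history_measure_def)

text \<open>The total mass is read off from the marginal on the empty set of coordinates, which is a
  probability measure.\<close>

lemma prob_space_hist: "prob_space hist"
proof (rule prob_space_distrD)
  show "(\<lambda>\<omega>. restrict \<omega> {}) \<in> hist \<rightarrow>\<^sub>M PiM {} (\<lambda>_. state_action A)"
    unfolding measurable_cong_sets[OF sets_hist refl] by (intro measurable_restrict_subset) simp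
  show "prob_space (distr hist (PiM {} (\<lambda>_. state_action A)) (\<lambda>\<omega>. restrict \<omega> {}))"
    unfolding history_measure_def by (simp add: IT.distr_lim IT.PF.prob_space_P del: restrict_apply)
qed

lemma pair_in_space_hist: "\<omega> \<in> space hist \<Longrightarrow> \<omega> n \<in> UNIV \<times> A"
  by (auto simp: space_hist space_PiM space_state_action)

lemma component_measurable:
  assumes "\<phi> \<in> borel_measurable (state_action A)"
  shows "(\<lambda>\<omega>. \<phi> (\<omega> n)) \<in> borel_measurable hist"
  unfolding measurable_cong_sets[OF sets_hist refl]
  by (intro measurable_compose[OF _ assms] measurable_component_singleton) simp

lemma integrable_component:
  fixes \<phi> :: "'s \<times> (real ^ 'k) \<Rightarrow> real"
  assumes "\<phi> \<in> borel_measurable (state_action A)" and "\<And>x. x \<in> UNIV \<times> A \<Longrightarrow> \<bar>\<phi> x\<bar> \<le> B"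
  shows "integrable hist (\<lambda>\<omega>. \<phi> (\<omega> n))"
proof -
  interpret prob_space hist
    by (rule prob_space_hist)
  show ?thesis
    using assms pair_in_space_hist
    by (intro integrable_const_bound[of _ B] component_measurable AE_I2) auto
qed

lemma integral_component:
  fixes \<phi> :: "'s \<times> (real ^ 'k) \<Rightarrow> real"
  assumes \<phi>: "\<phi> \<in> borel_measurable (state_action A)" "\<And>x. x \<in> UNIV \<times> A \<Longrightarrow> \<bar>\<phi> x\<bar> \<le> B"
  shows "(\<integral>\<omega>. \<phi> (\<omega> n) \<partial>hist) =
    (\<integral>h. (\<integral>s. \<phi> (s, \<sigma> n h s) \<partial>(case n of 0 \<Rightarrow> return borel s\<^sub>0 | Suc m \<Rightarrow> p (h m)))
      \<partial>IT.C 0 n (\<lambda>_. undefined))"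
proof -
  have "(\<integral>\<omega>. \<phi> (\<omega> n) \<partial>hist) =
      (\<integral>h. (\<integral>x. \<phi> x \<partial>step_kernel A p \<sigma> s\<^sub>0 n h) \<partial>IT.C 0 n (\<lambda>_. undefined))"
    unfolding history_measure_def
    using \<phi> by (intro IT.integral_lim_component[where B=B]) (auto simp: space_state_action)
  also have "\<dots> = (\<integral>h. (\<integral>s. \<phi> (s, \<sigma> n h s)
      \<partial>(case n of 0 \<Rightarrow> return borel s\<^sub>0 | Suc m \<Rightarrow> p (h m))) \<partial>IT.C 0 n (\<lambda>_. undefined))"
    by (intro Bochner_Integration.integral_cong refl integral_step_kernel strategy \<phi>(1))
      (simp add: IT.space_C)
  finally show ?thesis .
qed

text \<open>The sign condition concerns feasible pairs only. By \<open>integral_component\<close>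
  the function is evaluated at the actions played by \<sigma>, which are feasible at every
  history.\<close>

lemma integral_component_nonneg:
  fixes \<phi> :: "'s \<times> (real ^ 'k) \<Rightarrow> real"
  assumes "\<phi> \<in> borel_measurable (state_action A)" "\<And>x. x \<in> UNIV \<times> A \<Longrightarrow> \<bar>\<phi> x\<bar> \<le> B"
    and "\<And>s a. a \<in> \<Gamma> s \<Longrightarrow> 0 \<le> \<phi> (s, a)"
  shows "0 \<le> (\<integral>\<omega>. \<phi> (\<omega> n) \<partial>hist)"
  using strategy assms(3)
  by (subst integral_component[OF assms(1,2)])
    (auto simp: IT.space_C strategy_def intro!: Bochner_Integration.integral_nonneg)

text \<open>The initial state has a point mass as its law. For the second claim, the tower property,
  both sides equal the integral of \<open>\<integral>s. f s \<partial>p (h n)\<close> over histories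
  \<open>h\<close> of length \<open>Suc n\<close>.\<close>

lemma integral_component_state:
  assumes f: "bounded_usc f"
  shows "(\<integral>\<omega>. f (fst (\<omega> 0)) \<partial>hist) = f s\<^sub>0"
    and "(\<integral>\<omega>. f (fst (\<omega> (Suc n))) \<partial>hist) = (\<integral>\<omega>. (\<integral>s. f s \<partial>p (\<omega> n)) \<partial>hist)"
proof -
  obtain B where B: "\<And>s. \<bar>f s\<bar> \<le> B"
    using bounded_usc_bound[OF f] by blast
  have fst: "(\<lambda>x. f (fst x)) \<in> borel_measurable (state_action A)"
    unfolding state_action_def by (intro measurable_compose[OF measurable_fst] bounded_usc_measurable f)
  have "prob_space (IT.C 0 0 (\<lambda>_. undefined))"
    by (intro IT.prob_space_C) simp
  then show "(\<integral>\<omega>. f (fst (\<omega> 0)) \<partial>hist) = f s\<^sub>0"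
    using integral_component[OF fst, of B 0] B bounded_usc_measurable[OF f]
    by (simp add: integral_return prob_space.prob_space del: IT.C.simps)
  let ?\<psi> = "\<lambda>x. \<integral>s. f s \<partial>p x"
  have "usc_on (UNIV \<times> A) ?\<psi>"
    using f kernel_usc by (simp add: usc_kernel_def bounded_usc_def)
  then have "?\<psi> \<in> borel_measurable (state_action A)"
    by (rule usc_on_imp_borel_measurable_state_action)
  then have "(\<lambda>h. ?\<psi> (h n)) \<in> borel_measurable (PiM {0..<Suc n} (\<lambda>_. state_action A))"
    by (intro measurable_compose[OF measurable_component_singleton]) simp
  from IT.integral_lim_restrict[OF this]
  show "(\<integral>\<omega>. f (fst (\<omega> (Suc n))) \<partial>hist) = (\<integral>\<omega>. ?\<psi> (\<omega> n) \<partial>hist)"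
    using integral_component[OF fst, of B "Suc n"] B
    by (simp add: history_measure_def del: IT.C.simps)
qed

section \<open>Discounted sums of expectations along the process\<close>

lemma strategy_value_sums:
  "(\<lambda>n. \<beta> ^ n * (\<integral>\<omega>. r (\<omega> n) \<partial>hist)) sums strategy_value A p r \<beta> \<sigma> s\<^sub>0"
proof -
  interpret prob_space hist
    by (rule prob_space_hist)
  obtain B where B: "\<And>x. x \<in> UNIV \<times> A \<Longrightarrow> \<bar>r x\<bar> \<le> B"
    using payoff_bound by blast
  have int: "integrable hist (\<lambda>\<omega>. r (\<omega> n))" for n
    using payoff_measurable B by (rule integrable_component)
  \<comment> \<open>This geometric majorant justifies exchanging the sum with the
    expectation.\<close>
  have geom: "summable (\<lambda>n. \<beta> ^ n * B)"
    using discount by (intro summable_mult2 summable_geometric) auto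
  have bound: "norm (\<beta> ^ n * r (\<omega> n)) \<le> \<beta> ^ n * B" if "\<omega> \<in> space hist" for \<omega> n
    using B[OF pair_in_space_hist[OF that]] discount by (simp add: abs_mult mult_left_mono)
  have "(\<lambda>n. \<integral>\<omega>. \<beta> ^ n * r (\<omega> n) \<partial>hist) sums (\<integral>\<omega>. (\<Sum>n. \<beta> ^ n * r (\<omega> n)) \<partial>hist)"
  proof (rule sums_integral)
    show "integrable hist (\<lambda>\<omega>. \<beta> ^ n * r (\<omega> n))" for n
      using int by simp
    show "AE \<omega> in hist. summable (\<lambda>n. norm (\<beta> ^ n * r (\<omega> n)))"
      using bound by (intro AE_I2 summable_comparison_test'[OF geom]) simp
    have "(\<integral>\<omega>. norm (\<beta> ^ n * r (\<omega> n)) \<partial>hist) \<le> \<beta> ^ n * B" for n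
      using bound int by (intro integral_le_const AE_I2) auto
    then show "summable (\<lambda>n. \<integral>\<omega>. norm (\<beta> ^ n * r (\<omega> n)) \<partial>hist)"
      by (intro summable_comparison_test'[OF geom]) simp
  qed
  then show ?thesis
    by (simp add: strategy_value_def)
qed

text \<open>Stated for arbitrary bounded u.s.c. \<open>f\<close>, so that the upper bound for all
  strategies and the equality for a maximising policy both follow from it.\<close>

lemma sums_bellman_defect:
  assumes f: "bounded_usc f"
  shows "(\<lambda>n. \<beta> ^ n * (\<integral>\<omega>. f (fst (\<omega> n)) - action_value f (\<omega> n) \<partial>hist)) sums
    (f s\<^sub>0 - strategy_value A p r \<beta> \<sigma> s\<^sub>0)"
proof -
  interpret prob_space hist
    by (rule prob_space_hist)
  obtain B where B: "\<And>s. \<bar>f s\<bar> \<le> B"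
    using bounded_usc_bound[OF f] by blast
  obtain C where C: "\<And>x. x \<in> UNIV \<times> A \<Longrightarrow> \<bar>r x\<bar> \<le> C"
    using payoff_bound by blast
  have fst: "(\<lambda>x. f (fst x)) \<in> borel_measurable (state_action A)"
    unfolding state_action_def by (intro measurable_compose[OF measurable_fst] bounded_usc_measurable f)
  have \<psi>: "(\<lambda>x. \<integral>s. f s \<partial>p x) \<in> borel_measurable (state_action A)"
    using f kernel_usc
    by (intro usc_on_imp_borel_measurable_state_action) (simp add: usc_kernel_def bounded_usc_def)
  define E where "E n = (\<integral>\<omega>. f (fst (\<omega> n)) \<partial>hist)" for n
  define R where "R n = (\<integral>\<omega>. r (\<omega> n) \<partial>hist)" for n
  have int: "integrable hist (\<lambda>\<omega>. f (fst (\<omega> n)))" "integrable hist (\<lambda>\<omega>. r (\<omega> n))"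
      "integrable hist (\<lambda>\<omega>. \<integral>s. f s \<partial>p (\<omega> n))" for n
    using B C integral_p_bound[OF f B]
    by (auto intro!: integrable_component[OF fst] integrable_component[OF payoff_measurable]
        integrable_component[OF \<psi>])
  \<comment> \<open>By the tower property the expected integral of \<open>f\<close> under
    \<open>p\<close> at index \<open>n\<close> is \<open>E (Suc n)\<close>, which makes the sum
    telescope.\<close>
  have D: "(\<integral>\<omega>. f (fst (\<omega> n)) - action_value f (\<omega> n) \<partial>hist) = E n - R n - \<beta> * E (Suc n)" for n
    using int by (simp add: action_value_def E_def R_def integral_component_state(2)[OF f])
  have defect: "\<beta> ^ n * (\<integral>\<omega>. f (fst (\<omega> n)) - action_value f (\<omega> n) \<partial>hist) =
      (\<beta> ^ n * E n - \<beta> ^ Suc n * E (Suc n)) - \<beta> ^ n * R n" for n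
    unfolding D by (simp add: algebra_simps)
  have "\<bar>E n\<bar> \<le> B" for n
  proof -
    have "E n \<le> B" "- B \<le> E n"
      unfolding E_def using B int(1)
      by (auto intro!: integral_le_const integral_ge_const simp: abs_le_iff minus_le_iff)
    then show ?thesis
      by simp
  qed
  then have "norm (\<beta> ^ n * E n) \<le> \<beta> ^ n * B" for n
    using discount by (simp add: abs_mult mult_left_mono)
  moreover have "(\<lambda>n. \<beta> ^ n * B) \<longlonglongrightarrow> 0"
    using discount by (intro tendsto_mult_left_zero LIMSEQ_power_zero) simp
  \<comment> \<open>The boundary term of the telescoping sum vanishes in the limit, leaving
    \<open>E 0\<close>, which is \<open>f s\<^sub>0\<close>.\<close>
  ultimately have "(\<lambda>n. \<beta> ^ n * E n) \<longlonglongrightarrow> 0"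
    by (intro Lim_null_comparison[of "\<lambda>n. \<beta> ^ n * E n"]) auto
  from telescope_sums'[OF this]
  have "(\<lambda>n. \<beta> ^ n * E n - \<beta> ^ Suc n * E (Suc n)) sums f s\<^sub>0"
    by (simp add: E_def integral_component_state(1)[OF f])
  from sums_diff[OF this strategy_value_sums]
  show ?thesis
    unfolding defect R_def .
qed

lemma defect_measurable:
  assumes "bounded_usc f"
  shows "(\<lambda>x. f (fst x) - action_value f x) \<in> borel_measurable (state_action A)"
  using usc_on_imp_borel_measurable_state_action[OF usc_on_action_value[OF assms]]
    measurable_compose[OF measurable_fst bounded_usc_measurable[OF assms]]
  by (intro borel_measurable_diff) (auto simp: state_action_def)

lemma defect_bounded:
  assumes "bounded_usc f"
  obtains B where "\<And>x. x \<in> UNIV \<times> A \<Longrightarrow> \<bar>f (fst x) - action_value f x\<bar> \<le> B"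
proof -
  obtain B where B: "\<And>s. \<bar>f s\<bar> \<le> B"
    using bounded_usc_bound[OF assms] by blast
  obtain C where C: "\<And>x. x \<in> UNIV \<times> A \<Longrightarrow> \<bar>r x\<bar> \<le> C"
    using payoff_bound by blast
  have "\<bar>f (fst x) - action_value f x\<bar> \<le> B + (C + \<beta> * B)" if "x \<in> UNIV \<times> A" for x
  proof -
    have "\<bar>\<integral>s. f s \<partial>p x\<bar> \<le> B"
      using integral_p_bound[OF assms B, of "snd x" "fst x"] that by auto
    then have "\<bar>\<beta> * (\<integral>s. f s \<partial>p x)\<bar> \<le> \<beta> * B"
      using discount by (simp add: abs_mult)
    then show ?thesis
      unfolding action_value_def using B[of "fst x"] C[OF that] by linarith
  qed
  then show ?thesis
    by (rule that)
qed

lemma strategy_value_le: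
  assumes f: "bounded_usc f" and "bellman \<Gamma> p r \<beta> f = f"
  shows "strategy_value A p r \<beta> \<sigma> s\<^sub>0 \<le> f s\<^sub>0"
proof -
  obtain B where B: "\<And>x. x \<in> UNIV \<times> A \<Longrightarrow> \<bar>f (fst x) - action_value f x\<bar> \<le> B"
    using defect_bounded[OF f] by blast
  have "0 \<le> (\<integral>\<omega>. f (fst (\<omega> n)) - action_value f (\<omega> n) \<partial>hist)" for n
    using bellman_ge[OF f] assms(2)
    by (intro integral_component_nonneg[OF defect_measurable[OF f] B]) auto
  then have "0 \<le> f s\<^sub>0 - strategy_value A p r \<beta> \<sigma> s\<^sub>0"
    using discount by (intro sums_le[OF _ sums_zero sums_bellman_defect[OF f]]) simp
  then show ?thesis
    by simp
qed

lemma strategy_value_eq: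
  assumes f: "bounded_usc f" and \<pi>: "\<sigma> = stationary_strategy \<pi>"
    and max: "\<And>s. f s = action_value f (s, \<pi> s)"
  shows "strategy_value A p r \<beta> \<sigma> s\<^sub>0 = f s\<^sub>0"
proof -
  obtain B where B: "\<And>x. x \<in> UNIV \<times> A \<Longrightarrow> \<bar>f (fst x) - action_value f x\<bar> \<le> B"
    using defect_bounded[OF f] by blast
  \<comment> \<open>After conditioning on the history, the integrand is evaluated at
    \<open>(s, \<pi> s)\<close>, where it is zero by \<open>max\<close>.\<close>
  have "(\<integral>\<omega>. f (fst (\<omega> n)) - action_value f (\<omega> n) \<partial>hist) = 0" for n
    using integral_component[OF defect_measurable[OF f] B]
    by (simp add: \<pi> stationary_strategy_def max[symmetric])
  with sums_bellman_defect[OF f] have "(\<lambda>n. 0) sums (f s\<^sub>0 - strategy_value A p r \<beta> \<sigma> s\<^sub>0)"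
    by simp
  then show ?thesis
    using sums_unique2[OF _ sums_zero] by fastforce
qed

end

section \<open>From Bellman fixed points to the value function\<close>

context usc_discounted_model
begin

lemma strategy_stationary_strategy:
  assumes "stationary_policy A \<Gamma> \<pi>"
  shows "strategy A \<Gamma> (stationary_strategy \<pi>)"
  using assms measurable_compose[OF measurable_snd, of \<pi> borel "restrict_space borel A"]
  by (auto simp: strategy_def stationary_policy_def stationary_strategy_def split_beta')

text \<open>A fixed point bounds the value of every strategy and is the value of a maximising
  stationary policy, so the supremum over strategies is a maximum. As \<open>f\<close> is an
  arbitrary fixed point, uniqueness is included.\<close>

lemma bellman_fixed_point_is_value:
  assumes f: "bounded_usc f" and fixed: "bellman \<Gamma> p r \<beta> f = f"
  shows "value_function A \<Gamma> p r \<beta> = f"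
    and "\<exists>\<pi>. stationary_policy A \<Gamma> \<pi> \<and> optimal_strategy A \<Gamma> p r \<beta> (stationary_strategy \<pi>)"
proof -
  obtain \<pi> where \<pi>: "stationary_policy A \<Gamma> \<pi>" "\<And>s. f s = action_value f (s, \<pi> s)"
    using bellman_maximiser_exists[OF f] fixed by metis
  have \<sigma>: "strategy A \<Gamma> (stationary_strategy \<pi>)"
    using \<pi>(1) by (rule strategy_stationary_strategy)
  have process: "strategy_process A \<Gamma> p r \<beta> \<sigma>" if "strategy A \<Gamma> \<sigma>" for \<sigma>
    using that by unfold_locales
  then have le: "strategy_value A p r \<beta> \<sigma> s \<le> f s" if "strategy A \<Gamma> \<sigma>" for \<sigma> s
    using strategy_process.strategy_value_le f fixed that by metis
  have eq: "strategy_value A p r \<beta> (stationary_strategy \<pi>) s = f s" for s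
    using process[OF \<sigma>] strategy_process.strategy_value_eq f \<pi>(2) by metis
  show V: "value_function A \<Gamma> p r \<beta> = f"
  proof
    fix s
    show "value_function A \<Gamma> p r \<beta> s = f s"
      unfolding value_function_def
    proof (rule cSup_eq_maximum)
      show "f s \<in> (\<lambda>\<sigma>. strategy_value A p r \<beta> \<sigma> s) ` {\<sigma>. strategy A \<Gamma> \<sigma>}"
        using \<sigma> by (intro image_eqI[where x="stationary_strategy \<pi>"]) (simp_all add: eq)
    qed (use le in auto)
  qed
  show "\<exists>\<pi>. stationary_policy A \<Gamma> \<pi> \<and> optimal_strategy A \<Gamma> p r \<beta> (stationary_strategy \<pi>)"
    using \<pi>(1) \<sigma> eq V by (auto simp: optimal_strategy_def)
qed

end

theorem theorem2p2:
  fixes A :: "(real ^ 'k) set"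
    and \<Gamma> :: "'s::polish_space \<Rightarrow> (real ^ 'k) set"
    and p :: "'s \<times> (real ^ 'k) \<Rightarrow> 's measure"
    and r :: "'s \<times> (real ^ 'k) \<Rightarrow> real"
    and \<beta> :: real
  assumes "discounted_model A \<Gamma> p r \<beta>"
    and "bounded_on (UNIV \<times> A) r" and "usc_on (UNIV \<times> A) r"
    and "usc_kernel A p"
    and "usc_correspondence A \<Gamma>"
    and "\<And>s. \<Gamma> s \<noteq> {}" and "\<And>s. compact (\<Gamma> s)"
  shows "(bounded_on UNIV (value_function A \<Gamma> p r \<beta>) \<and>
          usc_on UNIV (value_function A \<Gamma> p r \<beta>) \<and>
          bellman \<Gamma> p r \<beta> (value_function A \<Gamma> p r \<beta>) = value_function A \<Gamma> p r \<beta>) \<and>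
         (\<forall>f. bounded_on UNIV f \<and> usc_on UNIV f \<and> bellman \<Gamma> p r \<beta> f = f \<longrightarrow>
            f = value_function A \<Gamma> p r \<beta>) \<and>
         (\<exists>\<pi>. stationary_policy A \<Gamma> \<pi> \<and>
            optimal_strategy A \<Gamma> p r \<beta> (stationary_strategy \<pi>))"
proof -
  interpret discounted_model A \<Gamma> p r \<beta>
    by fact
  interpret usc_discounted_model A \<Gamma> p r \<beta>
    using assms by unfold_locales
  obtain v where v: "bounded_usc v" "bellman \<Gamma> p r \<beta> v = v"
    using bellman_fixed_point_exists by blast
  have "value_function A \<Gamma> p r \<beta> = v"
    using bellman_fixed_point_is_value(1)[OF v] .
  \<comment> \<open>\<open>v\<close> transfers its properties to the value function; any other fixed
    point equals the value function by the same lemma.\<close>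
  then show ?thesis
    using v bellman_fixed_point_is_value unfolding bounded_usc_def by metis
qed

end
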